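(* With $L$, its basis $\mathcal{B}_L$, and $\blacktriangleright=\triangleright+\diamond$ as defined in the context: for all $w\in\mathcal{B}_L$ the set $$\{(u,v)\in\mathcal{B}_L\times\mathcal{B}_L:\ \langle u\blacktriangleright v,w\rangle\neq0\}$$ is finite.
   Context: Let $\mathbb{N}=\{0,1,\dots\}$, $d\ge1$, $\mathbb{N}^d_*=\mathbb{N}^d\setminus\{\mathbf 0\}$, $\mathbf e_i$ the canonical basis vectors, $|\mathbf n|=n_1+\dots+n_d$, and fix $\alpha\in(0,1)$. $\mathcal{A}:=\mathbb{R}[\mathsf z_k,\mathsf z_{\mathbf n}]_{k\in\mathbb{N},\mathbf n\in\mathbb{N}^d_*}$ is the polynomial algebra with unit $\mathbf 1$. $\mathcal{M}$ is the set of finitely supported $\gamma:\mathbb{N}\sqcup\mathbb{N}^d_*\to\mathbb{N}$, $\mathsf z^\gamma:=\prod_i\mathsf z_i^{\gamma_i}$, and $|\gamma|:=\alpha\sum_{k\ge0}\gamma_k+\sum_{\mathbf n\ne\mathbf 0}|\mathbf n|\gamma_{\mathbf n}$. Derivations of $\mathcal{A}$: $D^{(\mathbf 0)}:=\sum_{k\ge0}(k+1)\mathsf z_{k+1}\partial_{\mathsf z_k}$, $D^{(\mathbf n)}:=\partial_{\mathsf z_{\mathbf n}}$ for $\mathbf n\in\mathbb{N}^d_*$, $\partial_i:=\sum_{\mathbf n\in\mathbb{N}^d}(n_i+1)\mathsf z_{\mathbf n+\mathbf e_i}D^{(\mathbf n)}$ for $1\le i\le d$. $L\subset\mathcal{A}\otimes\mathrm{Der}(\mathcal{A})$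 is the subspace with linear basis $$\mathcal{B}_L:=\{\mathbf 1\otimes\partial_i\}_{1\le i\le d}\cup\{\mathsf z^\gamma\otimes D^{(\mathbf n)}:\gamma\in\mathcal{M},\ \mathbf n\in\mathbb{N}^d,\ |\gamma|>|\mathbf n|\}.$$ On $L$: $(a_1\otimes D_1)\triangleright(a_2\otimes D_2):=a_1D_1(a_2)\otimes D_2$. The bilinear operation $\diamond$ is given by $(\mathbf 1\otimes\partial_i)\diamond(\mathsf z^\gamma\otimes D^{(\mathbf n)})=-n_i\,\mathsf z^\gamma\otimes D^{(\mathbf n-\mathbf e_i)}$ (zero if $n_i=0$), all other products of elements of $\mathcal{B}_L$ being zero. $L$ is stable under both operations, and $\blacktriangleright:=\triangleright+\diamond$. For $x\in L$ and $w\in\mathcal{B}_L$, $\langle x,w\rangle$ is the coefficient of $w$ in the expansion of $x$ in the basis $\mathcal{B}_L$. *)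

theory Defs
  imports "HOL-Analysis.Analysis" "HOL-Analysis.Finite_Function_Topology"
begin

section \<open>Finitely supported functions as vector spaces\<close>

lemma lookup_scaleR [simp]:
  "Poly_Mapping.lookup (c *\<^sub>R p) k = c *\<^sub>R Poly_Mapping.lookup p k"
proof -
  have "finite {i. c *\<^sub>R Poly_Mapping.lookup p i \<noteq> 0}"
    by (rule finite_subset[OF _ finite_lookup[of p]]) auto
  then show ?thesis by (simp add: scaleR_poly_mapping_def)
qed

lemma linear_lookup: "linear (\<lambda>p. Poly_Mapping.lookup p k)"
  by (rule linearI) (simp_all add: lookup_add)

lemma scaleR_single: "c *\<^sub>R Poly_Mapping.single k b = Poly_Mapping.single k (c *\<^sub>R b)"
  by (rule poly_mapping_eqI) (simp add: lookup_single when_def)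

lemma linear_single: "linear (Poly_Mapping.single k)"
  by (rule linearI) (simp_all add: single_add scaleR_single)

lemma poly_mapping_eq_sum_single:
  fixes p :: "'a \<Rightarrow>\<^sub>0 'b::comm_monoid_add"
  shows "p = (\<Sum>k\<in>Poly_Mapping.keys p. Poly_Mapping.single k (Poly_Mapping.lookup p k))"
  by (rule poly_mapping_eqI)
     (auto simp: lookup_sum lookup_single when_def in_keys_iff)

lemma keys_sum_superset:
  assumes "\<And>k. linear (f k)" "finite K" "Poly_Mapping.keys p \<subseteq> K"
  shows "(\<Sum>k\<in>Poly_Mapping.keys p. f k (Poly_Mapping.lookup p k))
       = (\<Sum>k\<in>K. f k (Poly_Mapping.lookup p k))"
  by (rule sum.mono_neutral_left) (use assms in \<open>auto simp: in_keys_iff linear_0\<close>)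

lemma linear_keys_sum:
  fixes f :: "'a \<Rightarrow> 'b::real_vector \<Rightarrow> 'c::real_vector"
  assumes f: "\<And>k. linear (f k)"
  shows "linear (\<lambda>p. \<Sum>k\<in>Poly_Mapping.keys p. f k (Poly_Mapping.lookup p k))"
proof (rule linearI)
  fix p q :: "'a \<Rightarrow>\<^sub>0 'b" and c :: real
  let ?K = "Poly_Mapping.keys p \<union> Poly_Mapping.keys q"
  have "(\<Sum>k\<in>Poly_Mapping.keys (p + q). f k (Poly_Mapping.lookup (p + q) k))
      = (\<Sum>k\<in>?K. f k (Poly_Mapping.lookup (p + q) k))"
    by (rule keys_sum_superset) (simp_all add: f keys_add)
  also have "\<dots> = (\<Sum>k\<in>?K. f k (Poly_Mapping.lookup p k)) + (\<Sum>k\<in>?K. f k (Poly_Mapping.lookup q k))"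
    by (simp add: lookup_add linear_add[OF f] sum.distrib)
  finally show "(\<Sum>k\<in>Poly_Mapping.keys (p + q). f k (Poly_Mapping.lookup (p + q) k))
      = (\<Sum>k\<in>Poly_Mapping.keys p. f k (Poly_Mapping.lookup p k))
      + (\<Sum>k\<in>Poly_Mapping.keys q. f k (Poly_Mapping.lookup q k))"
    by (simp add: keys_sum_superset[of f ?K p] keys_sum_superset[of f ?K q] f)
  have "(\<Sum>k\<in>Poly_Mapping.keys (c *\<^sub>R p). f k (Poly_Mapping.lookup (c *\<^sub>R p) k))
      = (\<Sum>k\<in>Poly_Mapping.keys p. f k (Poly_Mapping.lookup (c *\<^sub>R p) k))"
    by (rule keys_sum_superset) (auto simp: f in_keys_iff)
  then show "(\<Sum>k\<in>Poly_Mapping.keys (c *\<^sub>R p). f k (Poly_Mapping.lookup (c *\<^sub>R p) k))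
      = c *\<^sub>R (\<Sum>k\<in>Poly_Mapping.keys p. f k (Poly_Mapping.lookup p k))"
    by (simp add: linear_scale[OF f] scaleR_right.sum)
qed

lemma keys_sum_single [simp]:
  assumes "linear (f k)"
  shows "(\<Sum>j\<in>Poly_Mapping.keys (Poly_Mapping.single k b). f j (Poly_Mapping.lookup (Poly_Mapping.single k b) j)) = f k b"
  using linear_0[OF assms] by (cases "b = 0") auto

lemma linear_eq_on_singles:
  assumes f: "linear f" and g: "linear g"
    and eq: "\<And>k b. f (Poly_Mapping.single k b) = g (Poly_Mapping.single k b)"
  shows "f p = g p"
  by (subst (1 2) poly_mapping_eq_sum_single[of p]) (simp add: linear_sum[OF f] linear_sum[OF g] eq)

section \<open>The polynomial algebra\<close>

typedef 'd nz_index = "{n :: nat ^ 'd. n \<noteq> 0}"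
proof
  show "(\<chi> i. 1) \<in> {n :: nat ^ 'd. n \<noteq> 0}" by (simp add: vec_eq_iff)
qed

text \<open>The dimension is \<open>d = CARD('d)\<close>. \<open>Inl k\<close> indexes the variable \<open>z\<^sub>k\<close>, and \<open>Inr n\<close> the variable
  \<open>z\<^bsub>n\<^esub>\<close> of a nonzero multi-index \<open>n\<close>; so \<open>Inl 0\<close> is not confused with the zero multi-index.\<close>

type_synonym 'd var = "nat + 'd nz_index"
type_synonym 'd mon = "'d var \<Rightarrow>\<^sub>0 nat"
type_synonym 'd alg = "'d mon \<Rightarrow>\<^sub>0 real"

text \<open>The index of the variable \<open>z\<^bsub>n\<^esub>\<close>; meaningful only for \<open>n \<noteq> 0\<close>.\<close>

definition vidx :: "nat ^ 'd \<Rightarrow> 'd var" where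
  "vidx n = Inr (Abs_nz_index n)"

definition size_idx :: "nat ^ 'd \<Rightarrow> nat" where
  "size_idx n = (\<Sum>i\<in>UNIV. n $ i)"

definition homog :: "real \<Rightarrow> 'd::finite mon \<Rightarrow> real" where
  "homog \<alpha> \<gamma> = \<alpha> * Sum_any (\<lambda>k. real (Poly_Mapping.lookup \<gamma> (Inl k)))
             + Sum_any (\<lambda>n. real (size_idx (Rep_nz_index n)) * real (Poly_Mapping.lookup \<gamma> (Inr n)))"

definition zvar :: "'d var \<Rightarrow> 'd alg" where
  "zvar v = Poly_Mapping.single (Poly_Mapping.single v 1) 1"

definition zmon :: "'d mon \<Rightarrow> 'd alg" where
  "zmon \<gamma> = Poly_Mapping.single \<gamma> 1"

lemma zmon_add: "zmon (\<gamma> + \<delta>) = zmon \<gamma> * zmon \<delta>"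
  by (simp add: zmon_def mult_single)

lemma zmon_0: "zmon 0 = 1"
  by (simp add: zmon_def)

lemma zmon_single: "zmon (Poly_Mapping.single v k) = zvar v ^ k"
proof (induction k)
  case (Suc k)
  have "Poly_Mapping.single v (Suc k) = Poly_Mapping.single v 1 + Poly_Mapping.single v k"
    by (simp flip: single_add)
  then show ?case using Suc by (simp add: zmon_add) (simp add: zvar_def zmon_def)
qed (simp add: zmon_0)

lemma zmon_sum: "finite K \<Longrightarrow> zmon (\<Sum>k\<in>K. f k) = (\<Prod>k\<in>K. zmon (f k))"
  by (induction K rule: finite_induct) (simp_all add: zmon_0 zmon_add)

lemma zmon_eq_prod: "zmon \<gamma> = (\<Prod>v\<in>Poly_Mapping.keys \<gamma>. zvar v ^ Poly_Mapping.lookup \<gamma> v)"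
  by (subst poly_mapping_eq_sum_single[of \<gamma>]) (simp add: zmon_sum zmon_single)

lemma single_eq_scaleR_zmon: "Poly_Mapping.single \<gamma> c = c *\<^sub>R zmon \<gamma>"
  by (simp add: zmon_def scaleR_single)

lemma linear_eq_on_zmon:
  fixes f g :: "'d alg \<Rightarrow> 'c::real_vector"
  assumes "linear f" "linear g" "\<And>\<gamma>. f (zmon \<gamma>) = g (zmon \<gamma>)"
  shows "f p = g p"
  by (rule linear_eq_on_singles) (simp_all add: assms single_eq_scaleR_zmon linear_scale)

lemma alg_scaleR_eq: "c *\<^sub>R (p :: 'd alg) = Poly_Mapping.single 0 c * p"
  unfolding mult_map_scale_conv_mult[symmetric]
  by (rule poly_mapping_eqI) (simp add: Poly_Mapping.map.rep_eq when_def)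

lemma alg_scaleR_left: "(c *\<^sub>R p) * q = c *\<^sub>R (p * q :: 'd alg)"
  by (simp add: alg_scaleR_eq mult.assoc)

lemma alg_scaleR_right: "p * (c *\<^sub>R q) = c *\<^sub>R (p * q :: 'd alg)"
  by (simp add: alg_scaleR_eq mult.left_commute)

lemma linear_alg_mult_left: "linear f \<Longrightarrow> linear (\<lambda>x. f x * (q :: 'd alg))"
  by (rule linearI) (simp_all add: linear_add linear_scale distrib_right alg_scaleR_left)

lemma linear_alg_mult_right: "linear f \<Longrightarrow> linear (\<lambda>x. (q :: 'd alg) * f x)"
  by (rule linearI) (simp_all add: linear_add linear_scale distrib_left alg_scaleR_right)

section \<open>Derivations\<close>

definition is_der :: "('d alg \<Rightarrow> 'd alg) \<Rightarrow> bool" where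
  "is_der D \<longleftrightarrow> linear D \<and> (\<forall>a b. D (a * b) = D a * b + a * D b)"

typedef 'd der = "{D :: 'd alg \<Rightarrow> 'd alg. is_der D}"
  morphisms app Abs_der
proof
  show "(\<lambda>_. 0) \<in> {D. is_der D}" by (simp add: is_der_def linear_iff)
qed

setup_lifting type_definition_der

instantiation der :: (type) real_vector
begin

lift_definition zero_der :: "'a der" is "\<lambda>_. 0"
  by (simp add: is_der_def linear_iff)

lift_definition plus_der :: "'a der \<Rightarrow> 'a der \<Rightarrow> 'a der" is "\<lambda>D E p. D p + E p"
  by (auto simp: is_der_def linear_compose_add algebra_simps)

lift_definition uminus_der :: "'a der \<Rightarrow> 'a der" is "\<lambda>D p. - D p"
  by (auto simp: is_der_def linear_compose_neg algebra_simps)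

lift_definition minus_der :: "'a der \<Rightarrow> 'a der \<Rightarrow> 'a der" is "\<lambda>D E p. D p - E p"
  by (auto simp: is_der_def linear_compose_sub algebra_simps)

lift_definition scaleR_der :: "real \<Rightarrow> 'a der \<Rightarrow> 'a der" is "\<lambda>c D p. c *\<^sub>R D p"
  by (auto simp: is_der_def linear_compose_scale_right scaleR_add_right alg_scaleR_left alg_scaleR_right)

instance
  by standard (transfer, simp add: fun_eq_iff algebra_simps)+

end

lemma linear_app: "linear (app D)"
  by transfer (simp add: is_der_def)

lemma app_mult: "app D (a * b) = app D a * b + a * app D b"
  by transfer (simp add: is_der_def)

lemma linear_app_left: "linear (\<lambda>D. app D p)"
  by (rule linearI; transfer; simp)

lemma is_derI:
  fixes D :: "'d alg \<Rightarrow> 'd alg"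
  assumes D: "linear D"
    and L: "\<And>\<gamma> \<delta>. D (zmon \<gamma> * zmon \<delta>) = D (zmon \<gamma>) * zmon \<delta> + zmon \<gamma> * D (zmon \<delta>)"
  shows "is_der D"
proof -
  have lr: "linear (\<lambda>a. D (a * b))" "linear (\<lambda>b. D (a * b))" for a b
    using linear_compose[OF linear_alg_mult_left[OF linear_id] D, of b]
      linear_compose[OF linear_alg_mult_right[OF linear_id] D, of a]
    by (simp_all add: o_def)
  have id: "linear (\<lambda>a :: 'd alg. a)" by (simp add: linear_iff)
  have rr1: "linear (\<lambda>a. D a * b + a * D b)" for b
    by (rule linear_compose_add[OF linear_alg_mult_left[OF D] linear_alg_mult_left[OF id]])
  have rr2: "linear (\<lambda>b. D a * b + a * D b)" for a
    by (rule linear_compose_add[OF linear_alg_mult_right[OF id] linear_alg_mult_right[OF D]])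
  have 1: "D (a * zmon \<delta>) = D a * zmon \<delta> + a * D (zmon \<delta>)" for a \<delta>
    by (rule linear_eq_on_zmon[OF lr(1) rr1]) (rule L)
  have "D (a * b) = D a * b + a * D b" for a b
    by (rule linear_eq_on_zmon[OF lr(2) rr2]) (rule 1)
  then show ?thesis using D by (simp add: is_der_def)
qed

lemma is_der_Sum_any:
  assumes E: "\<And>k. is_der (E k)" and fin: "\<And>p. finite {k. E k p \<noteq> 0}"
  shows "is_der (\<lambda>p. Sum_any (\<lambda>k. E k p))"
proof -
  have lin: "linear (E k)" for k using E by (simp add: is_der_def)
  have "linear (\<lambda>p. Sum_any (\<lambda>k. E k p))"
  proof (rule linearI)
    show "Sum_any (\<lambda>k. E k (p + q)) = Sum_any (\<lambda>k. E k p) + Sum_any (\<lambda>k. E k q)" for p q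
      by (simp add: linear_add[OF lin] Sum_any.distrib fin)
    show "Sum_any (\<lambda>k. E k (c *\<^sub>R p)) = c *\<^sub>R Sum_any (\<lambda>k. E k p)" for c p
      unfolding linear_scale[OF lin] alg_scaleR_eq[of c, where p = "E _ _"]
        alg_scaleR_eq[of c, where p = "Sum_any _"]
      by (rule Sum_any_right_distrib[OF fin, symmetric])
  qed
  moreover have "Sum_any (\<lambda>k. E k (a * b)) = Sum_any (\<lambda>k. E k a) * b + a * Sum_any (\<lambda>k. E k b)" for a b
  proof -
    have "finite {k. E k a * b \<noteq> 0}" by (rule finite_subset[OF _ fin[of a]]) auto
    moreover have "finite {k. a * E k b \<noteq> 0}" by (rule finite_subset[OF _ fin[of b]]) auto
    ultimately show ?thesis using E
      by (simp add: is_der_def Sum_any.distrib Sum_any_left_distrib[OF fin] Sum_any_right_distrib[OF fin])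
  qed
  ultimately show ?thesis by (simp add: is_der_def)
qed

lemma is_der_mult: "is_der D \<Longrightarrow> is_der (\<lambda>p. a * D p)"
  by (simp add: is_der_def linear_alg_mult_right algebra_simps)

text \<open>The partial derivative in the direction of the variable \<open>v\<close>. Where subtraction of
  exponents is truncated, the coefficient vanishes.\<close>

definition pd :: "'d var \<Rightarrow> 'd alg \<Rightarrow> 'd alg" where
  "pd v p = (\<Sum>\<gamma>\<in>Poly_Mapping.keys p.
     Poly_Mapping.single (\<gamma> - Poly_Mapping.single v 1) (Poly_Mapping.lookup p \<gamma> * real (Poly_Mapping.lookup \<gamma> v)))"

lemma pd_summand_linear:
  "linear (\<lambda>c :: real. Poly_Mapping.single (\<gamma> - Poly_Mapping.single v 1) (c * real (Poly_Mapping.lookup \<gamma> v)))"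
  by (rule linearI) (simp_all add: distrib_right single_add scaleR_single mult.assoc)

lemma linear_pd: "linear (pd v)"
  using linear_keys_sum[of "\<lambda>\<gamma> c. Poly_Mapping.single (\<gamma> - Poly_Mapping.single v 1) (c * real (Poly_Mapping.lookup \<gamma> v))",
      OF pd_summand_linear] by (simp add: pd_def[abs_def])

lemma pd_zmon: "pd v (zmon \<gamma>) = real (Poly_Mapping.lookup \<gamma> v) *\<^sub>R zmon (\<gamma> - Poly_Mapping.single v 1)"
  unfolding pd_def zmon_def by (simp add: scaleR_single)

lemma pd_zvar: "pd v (zvar w) = (if v = w then 1 else 0)"
  using pd_zmon[of v "Poly_Mapping.single w 1"]
  by (simp add: zvar_def zmon_def lookup_single when_def)

lemma is_der_pd: "is_der (pd v)"
proof (rule is_derI[OF linear_pd])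
  fix \<gamma> \<delta> :: "'a mon"
  have shift: "real (Poly_Mapping.lookup \<gamma> v) *\<^sub>R zmon (\<gamma> + \<delta> - Poly_Mapping.single v 1)
      = real (Poly_Mapping.lookup \<gamma> v) *\<^sub>R (zmon (\<gamma> - Poly_Mapping.single v 1) * zmon \<delta>)" for \<gamma> \<delta> :: "'a mon"
  proof (cases "Poly_Mapping.lookup \<gamma> v = 0")
    case False
    have "\<gamma> + \<delta> - Poly_Mapping.single v 1 = (\<gamma> - Poly_Mapping.single v 1) + \<delta>"
      using False by (intro poly_mapping_eqI) (auto simp: lookup_add lookup_minus lookup_single when_def)
    then show ?thesis by (simp add: zmon_add)
  qed simp
  have "pd v (zmon \<gamma> * zmon \<delta>)
      = real (Poly_Mapping.lookup \<gamma> v) *\<^sub>R zmon (\<gamma> + \<delta> - Poly_Mapping.single v 1)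
      + real (Poly_Mapping.lookup \<delta> v) *\<^sub>R zmon (\<delta> + \<gamma> - Poly_Mapping.single v 1)"
    by (simp add: pd_zmon lookup_add scaleR_add_left add.commute[of \<delta> \<gamma>] flip: zmon_add)
  then show "pd v (zmon \<gamma> * zmon \<delta>) = pd v (zmon \<gamma>) * zmon \<delta> + zmon \<gamma> * pd v (zmon \<delta>)"
    unfolding shift by (simp only: pd_zmon alg_scaleR_left alg_scaleR_right mult.commute)
qed

lemma finite_pd_ne_0: "finite {v. pd v p \<noteq> 0}"
proof (rule finite_subset)
  show "{v. pd v p \<noteq> 0} \<subseteq> (\<Union>\<gamma>\<in>Poly_Mapping.keys p. Poly_Mapping.keys \<gamma>)"
  proof
    fix v assume "v \<in> {v. pd v p \<noteq> 0}"
    then have "pd v p \<noteq> 0" by simp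
    then obtain \<gamma> where "\<gamma> \<in> Poly_Mapping.keys p"
      "Poly_Mapping.single (\<gamma> - Poly_Mapping.single v 1) (Poly_Mapping.lookup p \<gamma> * real (Poly_Mapping.lookup \<gamma> v)) \<noteq> 0"
      unfolding pd_def by (metis (no_types, lifting) sum.neutral)
    then show "v \<in> (\<Union>\<gamma>\<in>Poly_Mapping.keys p. Poly_Mapping.keys \<gamma>)"
      by (intro UN_I[of \<gamma>]) (auto simp: in_keys_iff intro: gr0I)
  qed
qed simp

lemma finite_pd_comp_ne_0: "inj f \<Longrightarrow> finite {k. pd (f k) p \<noteq> 0}"
  using finite_vimageI[OF finite_pd_ne_0[of p], of f] by (simp add: vimage_def)

text \<open>The infinite sums below have only finitely many nonzero terms at each polynomial, and
  \<^const>\<open>Sum_any\<close> adds up these.\<close>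

lift_definition Dzero :: "'d der" is
  "\<lambda>p. Sum_any (\<lambda>k. of_nat (k + 1) * zvar (Inl (k + 1)) * pd (Inl k) p)"
proof (rule is_der_Sum_any)
  show "is_der (\<lambda>p. of_nat (k + 1) * zvar (Inl (k + 1)) * pd (Inl k) p)" for k
    by (rule is_der_mult[OF is_der_pd])
  show "finite {k. of_nat (k + 1) * zvar (Inl (k + 1)) * pd (Inl k) p \<noteq> 0}" for p
    by (rule finite_subset[OF _ finite_pd_comp_ne_0[of Inl p]]) auto
qed

lift_definition Dvar :: "'d var \<Rightarrow> 'd der" is pd
  by (rule is_der_pd)

definition Dop :: "nat ^ 'd \<Rightarrow> 'd der" where
  "Dop n = (if n = 0 then Dzero else Dvar (vidx n))"

lemma finite_Dop_ne_0: "finite {n. app (Dop n) p \<noteq> 0}"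
proof (rule finite_subset)
  show "{n. app (Dop n) p \<noteq> 0} \<subseteq> insert 0 (Rep_nz_index ` {m. pd (Inr m) p \<noteq> 0})"
  proof
    fix n assume n: "n \<in> {n. app (Dop n) p \<noteq> 0}"
    show "n \<in> insert 0 (Rep_nz_index ` {m. pd (Inr m) p \<noteq> 0})"
    proof (cases "n = 0")
      case False
      then have "n = Rep_nz_index (Abs_nz_index n)" by (simp add: Abs_nz_index_inverse)
      moreover have "pd (Inr (Abs_nz_index n)) p \<noteq> 0"
        using n False by (simp add: Dop_def Dvar.rep_eq vidx_def)
      ultimately show ?thesis by blast
    qed simp
  qed
qed (simp add: finite_pd_comp_ne_0)

lift_definition partial :: "'d \<Rightarrow> 'd::finite der" is
  "\<lambda>i p. Sum_any (\<lambda>n. of_nat (n $ i + 1) * zvar (vidx (n + axis i 1)) * app (Dop n) p)"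
proof (rule is_der_Sum_any)
  fix i :: 'd
  show "is_der (\<lambda>p. of_nat (n $ i + 1) * zvar (vidx (n + axis i 1)) * app (Dop n) p)" for n
    by (rule is_der_mult) (use app[of "Dop n"] in simp)
  show "finite {n. of_nat (n $ i + 1) * zvar (vidx (n + axis i 1)) * app (Dop n) p \<noteq> 0}" for p
    by (rule finite_subset[OF _ finite_Dop_ne_0[of p]]) auto
qed

section \<open>The tensor product\<close>

text \<open>Since the monomials form a basis of \<open>'d alg\<close>, the tensor product of \<open>'d alg\<close> with a vector
  space \<open>V\<close> is the space of finitely supported maps from monomials to \<open>V\<close>; the element \<open>x\<close> stands
  for the sum of all \<open>zmon \<gamma> \<otimes> x(\<gamma>)\<close>. The universal property is \<open>tensor_universal\<close> below.\<close>

type_synonym 'd tens = "'d mon \<Rightarrow>\<^sub>0 'd der"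

definition tensor :: "'d alg \<Rightarrow> 'd der \<Rightarrow> 'd tens" where
  "tensor a D = Poly_Mapping.map (\<lambda>c. c *\<^sub>R D) a"

lemma lookup_tensor: "Poly_Mapping.lookup (tensor a D) \<gamma> = Poly_Mapping.lookup a \<gamma> *\<^sub>R D"
  by (simp add: tensor_def Poly_Mapping.map.rep_eq when_def)

lemma tensor_zmon: "tensor (zmon \<gamma>) D = Poly_Mapping.single \<gamma> D"
  by (rule poly_mapping_eqI) (simp add: lookup_tensor zmon_def lookup_single when_def)

lemma bilinear_tensor: "bilinear tensor"
  unfolding bilinear_def
  by (intro conjI allI linearI poly_mapping_eqI) (simp_all add: lookup_tensor lookup_add algebra_simps)

lemma linear_tensor_left: "linear (\<lambda>a. tensor a D)"
  and linear_tensor_right: "linear (tensor a)"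
  by (fact bilinear_tensor[unfolded bilinear_def, THEN conjunct2, rule_format])
     (fact bilinear_tensor[unfolded bilinear_def, THEN conjunct1, rule_format])

lemma tensor_universal:
  fixes f :: "'d alg \<Rightarrow> 'd der \<Rightarrow> 'c::real_vector"
  assumes f: "bilinear f"
  shows "\<exists>!g. linear g \<and> (\<forall>a D. g (tensor a D) = f a D)"
proof
  let ?g = "\<lambda>x. \<Sum>\<gamma>\<in>Poly_Mapping.keys x. f (zmon \<gamma>) (Poly_Mapping.lookup x \<gamma>)"
  have fr: "linear (f a)" for a using f by (simp add: bilinear_def)
  have fl: "linear (\<lambda>a. f a D)" for D using f by (simp add: bilinear_def)
  have g: "linear ?g" by (rule linear_keys_sum) (rule fr)
  have "?g (tensor a D) = f a D" for a D
  proof (rule linear_eq_on_zmon[where f = "\<lambda>a. ?g (tensor a D)" and g = "\<lambda>a. f a D"])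
    show "linear (\<lambda>a. ?g (tensor a D))" using linear_compose[OF linear_tensor_left g] by (simp add: o_def)
    show "?g (tensor (zmon \<gamma>) D) = f (zmon \<gamma>) D" for \<gamma>
      unfolding tensor_zmon by (rule keys_sum_single) (rule fr)
  qed (rule fl)
  then show "linear ?g \<and> (\<forall>a D. ?g (tensor a D) = f a D)" using g by blast
  fix h assume h: "linear h \<and> (\<forall>a D. h (tensor a D) = f a D)"
  show "h = ?g"
  proof
    fix x
    show "h x = ?g x"
    proof (rule linear_eq_on_singles[OF _ g])
      show "linear h" using h by blast
      show "h (Poly_Mapping.single k b) = ?g (Poly_Mapping.single k b)" for k b
        using h by (subst keys_sum_single) (simp_all add: fr flip: tensor_zmon)
    qed
  qed
qed

section \<open>The space and its products\<close>

text \<open>The bilinear extension of \<open>(a \<otimes> D) \<triangleright> (b \<otimes> E) = a D(b) \<otimes> E\<close>; see \<open>tri_tensor\<close>.\<close>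

definition tri :: "'d tens \<Rightarrow> 'd tens \<Rightarrow> 'd tens" where
  "tri x y = (\<Sum>\<gamma>\<in>Poly_Mapping.keys x. \<Sum>\<delta>\<in>Poly_Mapping.keys y.
     tensor (zmon \<gamma> * app (Poly_Mapping.lookup x \<gamma>) (zmon \<delta>)) (Poly_Mapping.lookup y \<delta>))"

definition basis_L :: "real \<Rightarrow> 'd::finite tens set" where
  "basis_L \<alpha> = {tensor 1 (partial i) | i. True}
     \<union> {tensor (zmon \<gamma>) (Dop n) | \<gamma> n. homog \<alpha> \<gamma> > real (size_idx n)}"

definition space_L :: "real \<Rightarrow> 'd::finite tens set" where
  "space_L \<alpha> = span (basis_L \<alpha>)"

definition coeff_L :: "real \<Rightarrow> 'd::finite tens \<Rightarrow> 'd tens \<Rightarrow> real" where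
  "coeff_L \<alpha> x w = representation (basis_L \<alpha>) x w"

text \<open>The bilinear extension to \<open>space_L\<close> of the prescribed products of basis elements; see
  \<open>dia_partial_Dop\<close> and the lemmas following it. If \<open>n $ i = 0\<close>, the truncated subtraction
  is harmless, as the coefficient vanishes.\<close>

definition dia :: "real \<Rightarrow> 'd::finite tens \<Rightarrow> 'd tens \<Rightarrow> 'd tens" where
  "dia \<alpha> x y = (\<Sum>i\<in>UNIV. Sum_any (\<lambda>(\<gamma>, n).
     (coeff_L \<alpha> x (tensor 1 (partial i)) * coeff_L \<alpha> y (tensor (zmon \<gamma>) (Dop n)) * - real (n $ i))
       *\<^sub>R tensor (zmon \<gamma>) (Dop (n - axis i 1))))"

definition btri :: "real \<Rightarrow> 'd::finite tens \<Rightarrow> 'd tens \<Rightarrow> 'd tens" where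
  "btri \<alpha> x y = tri x y + dia \<alpha> x y"

section \<open>Well-definedness\<close>

lemma app_Dzero_zvar_0: "app Dzero (zvar (Inl 0)) = zvar (Inl 1)"
proof -
  have "app Dzero (zvar (Inl 0)) = Sum_any (\<lambda>k :: nat. of_nat (k + 1) * zvar (Inl (k + 1)) * pd (Inl k) (zvar (Inl 0)))"
    by (simp add: Dzero.rep_eq)
  also have "\<dots> = (\<Sum>k\<in>{0}. of_nat (k + 1) * zvar (Inl (k + 1)) * pd (Inl k) (zvar (Inl 0)))"
    by (rule Sum_any.expand_superset) (auto simp: pd_zvar split: if_splits)
  finally show ?thesis by (simp add: pd_zvar)
qed

lemma app_Dzero_zvar_vidx: "app Dzero (zvar (vidx n)) = 0"
proof -
  have "app Dzero (zvar (vidx n)) = Sum_any (\<lambda>k :: nat. of_nat (k + 1) * zvar (Inl (k + 1)) * pd (Inl k) (zvar (vidx n)))"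
    by (simp add: Dzero.rep_eq)
  also have "\<dots> = Sum_any (\<lambda>k :: nat. 0)"
    by (rule arg_cong[where f = Sum_any]) (simp add: fun_eq_iff pd_zvar vidx_def)
  finally show ?thesis by simp
qed

lemma app_Dop_zvar_vidx: "m \<noteq> 0 \<Longrightarrow> app (Dop n) (zvar (vidx m)) = (if n = m then 1 else 0)"
  by (auto simp: Dop_def app_Dzero_zvar_vidx Dvar.rep_eq pd_zvar) (simp_all add: vidx_def Abs_nz_index_inject)

lemma app_Dop_zvar_0: "app (Dop n) (zvar (Inl 0)) = (if n = 0 then zvar (Inl 1) else 0)"
  using app_Dzero_zvar_0 by (auto simp: Dop_def Dvar.rep_eq pd_zvar vidx_def)

lemma app_partial_zvar_0: "app (partial i) (zvar (Inl 0)) = zvar (vidx (axis i 1)) * zvar (Inl 1)"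
proof -
  have "app (partial i) (zvar (Inl 0))
      = (\<Sum>n\<in>{0}. of_nat (n $ i + 1) * zvar (vidx (n + axis i 1)) * app (Dop n) (zvar (Inl 0)))"
    unfolding partial.rep_eq by (rule Sum_any.expand_superset) (auto simp: app_Dop_zvar_0 split: if_splits)
  then show ?thesis by (simp add: app_Dop_zvar_0)
qed

text \<open>Linear functionals dual to the basis, which separate the basis elements.\<close>

definition phi :: "nat ^ 'd \<Rightarrow> 'd der \<Rightarrow> real" where
  "phi n D = (if n = 0 then Poly_Mapping.lookup (app D (zvar (Inl 0))) (Poly_Mapping.single (Inl 1) 1)
     else Poly_Mapping.lookup (app D (zvar (vidx n))) 0)"

definition psi :: "'d::finite \<Rightarrow> 'd der \<Rightarrow> real" where
  "psi i D = Poly_Mapping.lookup (app D (zvar (Inl 0)))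
     (Poly_Mapping.single (vidx (axis i 1)) 1 + Poly_Mapping.single (Inl 1) 1)"

lemma linear_lookup_app: "linear (\<lambda>D. Poly_Mapping.lookup (app D p) \<beta>)"
  using linear_compose[OF linear_app_left linear_lookup] by (simp add: o_def)

lemma linear_phi: "linear (phi n)"
  using linear_lookup_app by (cases "n = 0") (simp_all add: phi_def[abs_def])

lemma linear_psi: "linear (psi i)"
  using linear_lookup_app by (simp add: psi_def[abs_def])

lemma inj_single_1: "Poly_Mapping.single a (1::nat) = Poly_Mapping.single b 1 \<longleftrightarrow> a = b"
  by (metis lookup_single_eq lookup_single_not_eq zero_neq_one)

lemma lookup_zvar: "Poly_Mapping.lookup (zvar v) \<beta> = (if \<beta> = Poly_Mapping.single v 1 then 1 else 0)"
  by (auto simp: zvar_def lookup_single when_def)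

lemma lookup_zvar_mult:
  "Poly_Mapping.lookup (zvar v * zvar w) \<beta> = (if \<beta> = Poly_Mapping.single v 1 + Poly_Mapping.single w 1 then 1 else 0)"
  by (auto simp: zvar_def mult_single lookup_single when_def)

lemma phi_Dop: "phi n (Dop m) = (if n = m then 1 else 0)"
  by (simp add: phi_def app_Dop_zvar_0 app_Dop_zvar_vidx lookup_zvar)

lemma vidx_axis_inj: "vidx (axis i 1) = vidx (axis j 1) \<longleftrightarrow> i = j"
  by (auto simp: vidx_def Abs_nz_index_inject axis_eq_axis vec_eq_iff axis_def)

lemma psi_partial: "psi i (partial j) = (if i = j then 1 else 0)"
proof -
  have "Poly_Mapping.single (vidx (axis i 1)) 1 + Poly_Mapping.single (Inl 1) 1
      = Poly_Mapping.single (vidx (axis j 1)) (1::nat) + Poly_Mapping.single (Inl 1) 1 \<longleftrightarrow> i = j"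
    unfolding add_right_cancel inj_single_1 vidx_axis_inj by auto
  then show ?thesis unfolding psi_def app_partial_zvar_0 lookup_zvar_mult by simp
qed

lemma psi_Dop: "psi i (Dop n) = 0"
proof -
  have "Poly_Mapping.single (Inl 1) 1
      \<noteq> Poly_Mapping.single (vidx (axis i 1)) (1::nat) + Poly_Mapping.single (Inl 1) 1"
  proof
    assume "Poly_Mapping.single (Inl 1) 1
      = Poly_Mapping.single (vidx (axis i 1)) (1::nat) + Poly_Mapping.single (Inl 1) 1"
    then have "Poly_Mapping.lookup (Poly_Mapping.single (Inl 1) 1) (vidx (axis i 1))
      = Poly_Mapping.lookup (Poly_Mapping.single (vidx (axis i 1)) (1::nat) + Poly_Mapping.single (Inl 1) 1) (vidx (axis i 1))"
      by simp
    then show False by (simp add: lookup_add)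
  qed
  then show ?thesis unfolding psi_def app_Dop_zvar_0 by (simp add: lookup_zvar)
qed

lemma tensor_zmon_Dop_inj [simp]:
  "tensor (zmon \<gamma>) (Dop n) = tensor (zmon \<delta>) (Dop m) \<longleftrightarrow> \<gamma> = \<delta> \<and> n = m"
proof
  assume "tensor (zmon \<gamma>) (Dop n) = tensor (zmon \<delta>) (Dop m)"
  then have "phi n (Poly_Mapping.lookup (tensor (zmon \<gamma>) (Dop n)) \<gamma>)
    = phi n (Poly_Mapping.lookup (tensor (zmon \<delta>) (Dop m)) \<gamma>)" by simp
  then show "\<gamma> = \<delta> \<and> n = m"
    by (auto simp: tensor_zmon lookup_single when_def phi_Dop linear_0[OF linear_phi] split: if_splits)
qed auto

lemma tensor_1_eq: "tensor 1 D = Poly_Mapping.single 0 D"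
  using tensor_zmon[of 0] by (simp add: zmon_0)

lemma tensor_partial_inj [simp]: "tensor 1 (partial i) = tensor 1 (partial j) \<longleftrightarrow> i = j"
proof
  assume "tensor 1 (partial i) = tensor 1 (partial j)"
  then have "partial i = partial j" by (metis tensor_1_eq lookup_single_eq)
  then have "psi i (partial i) = psi i (partial j)" by simp
  then show "i = j" by (simp add: psi_partial split: if_splits)
qed auto

lemma tensor_partial_neq_Dop [simp]:
  "tensor 1 (partial i) \<noteq> tensor (zmon \<gamma>) (Dop n)" "tensor (zmon \<gamma>) (Dop n) \<noteq> tensor 1 (partial i)"
proof -
  show "tensor 1 (partial i) \<noteq> tensor (zmon \<gamma>) (Dop n)"
  proof
    assume eq: "tensor 1 (partial i) = tensor (zmon \<gamma>) (Dop n)"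
    have "psi i (Poly_Mapping.lookup (tensor 1 (partial i)) 0) = 1"
      by (simp add: tensor_1_eq psi_partial)
    moreover have "psi i (Poly_Mapping.lookup (tensor (zmon \<gamma>) (Dop n)) 0) = 0"
      by (simp add: tensor_zmon lookup_single when_def psi_Dop linear_0[OF linear_psi])
    ultimately show False using eq by simp
  qed
  then show "tensor (zmon \<gamma>) (Dop n) \<noteq> tensor 1 (partial i)" by metis
qed

lemma homog_0 [simp]: "homog \<alpha> 0 = 0"
  by (simp add: homog_def)

lemma zmon_Dop_in_basis: "homog \<alpha> \<gamma> > real (size_idx n) \<Longrightarrow> tensor (zmon \<gamma>) (Dop n) \<in> basis_L \<alpha>"
  by (auto simp: basis_L_def)

lemma zmon_Dop_in_basis_iff [simp]:
  "tensor (zmon \<gamma>) (Dop n) \<in> basis_L \<alpha> \<longleftrightarrow> homog \<alpha> \<gamma> > real (size_idx n)"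
  by (auto simp: basis_L_def)

lemma partial_in_basis [simp]: "tensor 1 (partial i) \<in> basis_L \<alpha>"
  by (auto simp: basis_L_def)

lemma basis_L_cases:
  assumes "w \<in> basis_L \<alpha>"
  obtains i where "w = tensor 1 (partial i)"
  | \<gamma> n where "w = tensor (zmon \<gamma>) (Dop n)" "homog \<alpha> \<gamma> > real (size_idx n)"
  using assms by (auto simp: basis_L_def)

lemma independent_if_dual:
  assumes "\<And>b. b \<in> B \<Longrightarrow> \<exists>f :: 'a::real_vector \<Rightarrow> real. linear f \<and> f b = 1 \<and> (\<forall>c\<in>B - {b}. f c = 0)"
  shows "independent B"
proof
  assume "dependent B"
  then obtain b where b: "b \<in> B" "b \<in> span (B - {b})" by (auto simp: dependent_def)
  from assms[OF b(1)] obtain f :: "'a \<Rightarrow> real"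
    where f: "linear f" "f b = 1" "\<And>c. c \<in> B - {b} \<Longrightarrow> f c = 0" by blast
  have "f b = 0" by (rule linear_eq_0_on_span[OF f(1) f(3) b(2)])
  with f(2) show False by simp
qed

text \<open>\<open>basis_L\<close> is indeed a basis of \<open>space_L\<close>.\<close>

lemma independent_basis_L: "independent (basis_L \<alpha> :: 'd::finite tens set)"
proof (rule independent_if_dual)
  fix b :: "'d tens" assume "b \<in> basis_L \<alpha>"
  then show "\<exists>f :: 'd tens \<Rightarrow> real. linear f \<and> f b = 1 \<and> (\<forall>c\<in>basis_L \<alpha> - {b}. f c = 0)"
  proof (cases rule: basis_L_cases)
    case (1 i)
    let ?f = "\<lambda>x :: 'd tens. psi i (Poly_Mapping.lookup x 0)"
    have "linear ?f" using linear_compose[OF linear_lookup linear_psi] by (simp add: o_def)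
    moreover have "?f b = 1" by (simp add: 1 tensor_1_eq psi_partial)
    moreover have "?f c = 0" if "c \<in> basis_L \<alpha> - {b}" for c
    proof -
      from that have "c \<in> basis_L \<alpha>" by simp
      then show ?thesis
      proof (cases rule: basis_L_cases)
        case (1 j)
        then show ?thesis using that \<open>b = _\<close> by (auto simp: tensor_1_eq psi_partial)
      next
        case (2 \<gamma> n)
        then show ?thesis by (auto simp: tensor_zmon lookup_single when_def psi_Dop linear_0[OF linear_psi])
      qed
    qed
    ultimately show ?thesis by - (rule exI[of _ ?f], blast)
  next
    case (2 \<gamma> n)
    let ?f = "\<lambda>x :: 'd tens. phi n (Poly_Mapping.lookup x \<gamma>)"
    have "linear ?f" using linear_compose[OF linear_lookup linear_phi] by (simp add: o_def)
    moreover have "?f b = 1" by (simp add: 2 tensor_zmon phi_Dop)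
    moreover have "?f c = 0" if "c \<in> basis_L \<alpha> - {b}" for c
    proof -
      have "\<gamma> \<noteq> 0" using 2 by auto
      from that have "c \<in> basis_L \<alpha>" by simp
      then show ?thesis
      proof (cases rule: basis_L_cases)
        case (1 j)
        then show ?thesis using \<open>\<gamma> \<noteq> 0\<close> by (simp add: tensor_1_eq lookup_single when_def linear_0[OF linear_phi])
      next
        case (2 \<delta> m)
        then show ?thesis using that \<open>b = _\<close>
          by (auto simp: tensor_zmon lookup_single when_def phi_Dop linear_0[OF linear_phi])
      qed
    qed
    ultimately show ?thesis by - (rule exI[of _ ?f], blast)
  qed
qed

lemma basis_in_space_L: "w \<in> basis_L \<alpha> \<Longrightarrow> w \<in> space_L \<alpha>"
  by (simp add: space_L_def span_base)

lemma coeff_L_basis: "v \<in> basis_L \<alpha> \<Longrightarrow> coeff_L \<alpha> v w = (if w = v then 1 else 0)"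
  by (simp add: coeff_L_def representation_basis[OF independent_basis_L])

lemma coeff_L_add: "x \<in> space_L \<alpha> \<Longrightarrow> y \<in> space_L \<alpha> \<Longrightarrow> coeff_L \<alpha> (x + y) w = coeff_L \<alpha> x w + coeff_L \<alpha> y w"
  by (simp add: coeff_L_def space_L_def representation_add[OF independent_basis_L])

lemma coeff_L_scaleR: "x \<in> space_L \<alpha> \<Longrightarrow> coeff_L \<alpha> (c *\<^sub>R x) w = c * coeff_L \<alpha> x w"
  by (simp add: coeff_L_def space_L_def representation_scale[OF independent_basis_L])

subsection \<open>The product \<open>\<triangleright>\<close>\<close>

lemma tri_linear_left: "linear (\<lambda>x. tri x y)"
  unfolding tri_def
proof (rule linear_keys_sum, rule linear_compose_sum, rule ballI)
  fix \<gamma> \<delta> :: "'a mon"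
  have "linear (\<lambda>D. zmon \<gamma> * app D (zmon \<delta>))"
    by (rule linear_alg_mult_right[OF linear_app_left])
  from linear_compose[OF this linear_tensor_left]
  show "linear (\<lambda>D. tensor (zmon \<gamma> * app D (zmon \<delta>)) (Poly_Mapping.lookup y \<delta>))"
    by (simp add: o_def)
qed

lemma tri_linear_right: "linear (\<lambda>y. tri x y)"
  unfolding tri_def
  by (rule linear_compose_sum, rule ballI, rule linear_keys_sum, rule linear_tensor_right)

lemma tri_single: "tri (Poly_Mapping.single \<gamma> D) (Poly_Mapping.single \<delta> E) = tensor (zmon \<gamma> * app D (zmon \<delta>)) E"
proof -
  let ?f = "\<lambda>\<gamma> D. \<Sum>\<delta>'\<in>Poly_Mapping.keys (Poly_Mapping.single \<delta> E).
    tensor (zmon \<gamma> * app D (zmon \<delta>')) (Poly_Mapping.lookup (Poly_Mapping.single \<delta> E) \<delta>')"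
  have 1: "linear (?f \<gamma>)"
  proof (rule linear_compose_sum, rule ballI)
    fix \<delta>' :: "'a mon"
    have "linear (\<lambda>D. zmon \<gamma> * app D (zmon \<delta>'))"
      by (rule linear_alg_mult_right[OF linear_app_left])
    from linear_compose[OF this linear_tensor_left]
    show "linear (\<lambda>D. tensor (zmon \<gamma> * app D (zmon \<delta>')) (Poly_Mapping.lookup (Poly_Mapping.single \<delta> E) \<delta>'))"
      by (simp add: o_def)
  qed
  have "tri (Poly_Mapping.single \<gamma> D) (Poly_Mapping.single \<delta> E) = ?f \<gamma> D"
    unfolding tri_def by (rule keys_sum_single[where f = ?f, OF 1])
  also have "\<dots> = tensor (zmon \<gamma> * app D (zmon \<delta>)) E"
    by (rule keys_sum_single[where f = "\<lambda>\<delta>. tensor (zmon \<gamma> * app D (zmon \<delta>))", OF linear_tensor_right])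
  finally show ?thesis .
qed

lemma tri_tensor: "tri (tensor a D) (tensor b E) = tensor (a * app D b) E"
proof -
  have id: "linear (\<lambda>a :: 'a alg. a)" by (simp add: linear_iff)
  have l1: "linear (\<lambda>a. tri (tensor a D) y)" for y
    using linear_compose[OF linear_tensor_left tri_linear_left] by (simp add: o_def)
  have r1: "linear (\<lambda>a. tensor (a * p) E)" for p
    using linear_compose[OF linear_alg_mult_left[OF id] linear_tensor_left] by (simp add: o_def)
  have l2: "linear (\<lambda>b. tri x (tensor b E))" for x
    using linear_compose[OF linear_tensor_left tri_linear_right] by (simp add: o_def)
  have r2: "linear (\<lambda>b. tensor (a * app D b) E)" for a
    using linear_compose[OF linear_alg_mult_right[OF linear_app] linear_tensor_left] by (simp add: o_def)
  have 1: "tri (tensor a D) (tensor (zmon \<delta>) E) = tensor (a * app D (zmon \<delta>)) E" for \<delta>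
    by (rule linear_eq_on_zmon[OF l1 r1]) (simp add: tensor_zmon tri_single)
  show ?thesis by (rule linear_eq_on_zmon[OF l2 r2]) (rule 1)
qed

subsection \<open>The product \<open>\<diamond>\<close>\<close>

lemma finite_coeff_L_Dop: "finite {(\<gamma>, n). coeff_L \<alpha> y (tensor (zmon \<gamma>) (Dop n)) \<noteq> 0}"
proof -
  have "inj (\<lambda>(\<gamma>, n). tensor (zmon \<gamma>) (Dop n))" by (auto simp: inj_def)
  from finite_vimageI[OF finite_representation[of "basis_L \<alpha>" y] this]
  show ?thesis by (simp add: coeff_L_def vimage_def case_prod_unfold)
qed

lemma dia_superset:
  assumes "finite S" "{(\<gamma>, n). coeff_L \<alpha> y (tensor (zmon \<gamma>) (Dop n)) \<noteq> 0} \<subseteq> S"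
  shows "dia \<alpha> x y = (\<Sum>i\<in>UNIV. \<Sum>(\<gamma>, n)\<in>S.
     (coeff_L \<alpha> x (tensor 1 (partial i)) * coeff_L \<alpha> y (tensor (zmon \<gamma>) (Dop n)) * - real (n $ i))
       *\<^sub>R tensor (zmon \<gamma>) (Dop (n - axis i 1)))"
  unfolding dia_def
  by (intro sum.cong refl Sum_any.expand_superset[OF assms(1)]) (use assms(2) in auto)

lemma dia_add_left:
  "x \<in> space_L \<alpha> \<Longrightarrow> x' \<in> space_L \<alpha> \<Longrightarrow> dia \<alpha> (x + x') y = dia \<alpha> x y + dia \<alpha> x' y"
  by (simp only: dia_superset[OF finite_coeff_L_Dop subset_refl] coeff_L_add
      distrib_right scaleR_add_left sum.distrib case_prod_unfold)

lemma dia_scaleR_left: "x \<in> space_L \<alpha> \<Longrightarrow> dia \<alpha> (c *\<^sub>R x) y = c *\<^sub>R dia \<alpha> x y"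
  by (simp add: dia_superset[OF finite_coeff_L_Dop subset_refl] coeff_L_scaleR
      scaleR_sum_right case_prod_unfold mult.assoc)

lemma dia_add_right:
  assumes "y \<in> space_L \<alpha>" "y' \<in> space_L \<alpha>"
  shows "dia \<alpha> x (y + y') = dia \<alpha> x y + dia \<alpha> x y'"
proof -
  let ?S = "\<lambda>y. {(\<gamma>, n). coeff_L \<alpha> y (tensor (zmon \<gamma>) (Dop n)) \<noteq> 0}"
  let ?U = "?S y \<union> ?S y' \<union> ?S (y + y')"
  have U: "finite ?U" by (simp add: finite_coeff_L_Dop)
  have S: "?S y \<subseteq> ?U" "?S y' \<subseteq> ?U" "?S (y + y') \<subseteq> ?U" by blast+
  show ?thesis
    unfolding dia_superset[OF U S(1)] dia_superset[OF U S(2)] dia_superset[OF U S(3)]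
    by (simp only: coeff_L_add[OF assms] distrib_left distrib_right scaleR_add_left sum.distrib case_prod_unfold)
qed

lemma dia_scaleR_right:
  assumes "y \<in> space_L \<alpha>"
  shows "dia \<alpha> x (c *\<^sub>R y) = c *\<^sub>R dia \<alpha> x y"
proof -
  have "{(\<gamma>, n). coeff_L \<alpha> (c *\<^sub>R y) (tensor (zmon \<gamma>) (Dop n)) \<noteq> 0}
      \<subseteq> {(\<gamma>, n). coeff_L \<alpha> y (tensor (zmon \<gamma>) (Dop n)) \<noteq> 0}"
    using assms by (auto simp: coeff_L_scaleR)
  from dia_superset[OF finite_coeff_L_Dop this] show ?thesis using assms
    by (simp add: dia_superset[OF finite_coeff_L_Dop subset_refl] coeff_L_scaleR
      scaleR_sum_right case_prod_unfold mult_ac)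
qed

lemma dia_partial_Dop:
  assumes "homog \<alpha> \<gamma> > real (size_idx n)"
  shows "dia \<alpha> (tensor 1 (partial i)) (tensor (zmon \<gamma>) (Dop n))
       = (- real (n $ i)) *\<^sub>R tensor (zmon \<gamma>) (Dop (n - axis i 1))"
proof -
  have "{(\<delta>, m). coeff_L \<alpha> (tensor (zmon \<gamma>) (Dop n)) (tensor (zmon \<delta>) (Dop m)) \<noteq> 0} \<subseteq> {(\<gamma>, n)}"
    using assms by (auto simp: coeff_L_basis split: if_splits)
  from dia_superset[OF _ this, of "tensor 1 (partial i)"]
  have "dia \<alpha> (tensor 1 (partial i)) (tensor (zmon \<gamma>) (Dop n))
      = (\<Sum>j\<in>UNIV. ((if j = i then 1 else 0) * - real (n $ j)) *\<^sub>R tensor (zmon \<gamma>) (Dop (n - axis j 1)))"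
    using assms by (simp add: coeff_L_basis)
  also have "\<dots> = (\<Sum>j\<in>UNIV. if j = i then (- real (n $ i)) *\<^sub>R tensor (zmon \<gamma>) (Dop (n - axis i 1)) else 0)"
    by (rule sum.cong) auto
  finally show ?thesis by simp
qed

lemma dia_Dop_left:
  "homog \<alpha> \<gamma> > real (size_idx n) \<Longrightarrow> dia \<alpha> (tensor (zmon \<gamma>) (Dop n)) y = 0"
  by (simp add: dia_superset[OF finite_coeff_L_Dop subset_refl] coeff_L_basis)

lemma dia_partial_right: "dia \<alpha> x (tensor 1 (partial i)) = 0"
  by (simp add: dia_superset[OF finite_coeff_L_Dop subset_refl] coeff_L_basis)

subsection \<open>Stability of the space\<close>

lemma size_idx_add: "size_idx (n + m) = size_idx n + size_idx m"
  by (simp add: size_idx_def sum.distrib)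

lemma size_idx_axis: "size_idx (axis i (Suc 0)) = 1"
  by (simp add: size_idx_def axis_def)

lemma size_idx_minus_le: "size_idx (n - m) \<le> size_idx n"
  by (auto simp: size_idx_def intro!: sum_mono)

lemma dia_in_space_L: "dia \<alpha> x y \<in> space_L \<alpha>"
proof -
  have *: "(coeff_L \<alpha> x (tensor 1 (partial i)) * coeff_L \<alpha> y (tensor (zmon \<gamma>) (Dop n)) * - real (n $ i))
       *\<^sub>R tensor (zmon \<gamma>) (Dop (n - axis i 1)) \<in> space_L \<alpha>" for i \<gamma> n
  proof (cases "coeff_L \<alpha> y (tensor (zmon \<gamma>) (Dop n)) = 0")
    case False
    then have "tensor (zmon \<gamma>) (Dop n) \<in> basis_L \<alpha>"
      unfolding coeff_L_def by (rule representation_ne_zero)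
    then have "tensor (zmon \<gamma>) (Dop (n - axis i 1)) \<in> basis_L \<alpha>"
      using size_idx_minus_le[of n "axis i 1"] by simp
    then show ?thesis unfolding space_L_def by (rule span_scale[OF span_base])
  qed (simp add: space_L_def span_zero)
  show ?thesis
    unfolding dia_superset[OF finite_coeff_L_Dop subset_refl] space_L_def case_prod_unfold
    by (rule span_sum, rule span_sum, rule *[unfolded space_L_def])
qed

definition weight :: "real \<Rightarrow> 'd::finite var \<Rightarrow> real" where
  "weight \<alpha> v = (case v of Inl k \<Rightarrow> \<alpha> | Inr n \<Rightarrow> real (size_idx (Rep_nz_index n)))"

lemma homog_eq_sum: "homog \<alpha> \<gamma> = (\<Sum>v\<in>Poly_Mapping.keys \<gamma>. real (Poly_Mapping.lookup \<gamma> v) * weight \<alpha> v)"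
proof -
  let ?K = "Poly_Mapping.keys \<gamma>" and ?l = "Poly_Mapping.lookup \<gamma>"
  let ?A = "Inl -` ?K :: nat set" and ?B = "Inr -` ?K :: 'a nz_index set"
  have fin: "finite ?A" "finite ?B" by (auto intro: finite_vimageI)
  have A: "Sum_any (\<lambda>k. real (?l (Inl k))) = (\<Sum>k\<in>?A. real (?l (Inl k)))"
    by (rule Sum_any.expand_superset[OF fin(1)]) (auto simp: in_keys_iff)
  have B: "Sum_any (\<lambda>n. real (size_idx (Rep_nz_index n)) * real (?l (Inr n)))
      = (\<Sum>n\<in>?B. real (size_idx (Rep_nz_index n)) * real (?l (Inr n)))"
    by (rule Sum_any.expand_superset[OF fin(2)]) (auto simp: in_keys_iff)
  have K: "?K = Inl ` ?A \<union> Inr ` ?B"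
  proof (rule set_eqI)
    show "v \<in> ?K \<longleftrightarrow> v \<in> Inl ` ?A \<union> Inr ` ?B" for v by (cases v) auto
  qed
  have "(\<Sum>v\<in>?K. real (?l v) * weight \<alpha> v)
      = (\<Sum>v\<in>Inl ` ?A. real (?l v) * weight \<alpha> v) + (\<Sum>v\<in>Inr ` ?B. real (?l v) * weight \<alpha> v)"
    using sum.union_disjoint[of "Inl ` ?A" "Inr ` ?B" "\<lambda>v. real (?l v) * weight \<alpha> v"] fin
    unfolding K[symmetric] by blast
  also have "\<dots> = homog \<alpha> \<gamma>"
    by (simp add: sum.reindex weight_def homog_def A B sum_distrib_left mult.commute
        del: image_vimage_eq)
  finally show ?thesis by simp
qed

lemma homog_superset:
  "finite K \<Longrightarrow> Poly_Mapping.keys \<gamma> \<subseteq> K \<Longrightarrow> homog \<alpha> \<gamma> = (\<Sum>v\<in>K. real (Poly_Mapping.lookup \<gamma> v) * weight \<alpha> v)"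
  unfolding homog_eq_sum by (rule sum.mono_neutral_left) (auto simp: in_keys_iff)

lemma homog_add: "homog \<alpha> (\<gamma> + \<delta>) = homog \<alpha> \<gamma> + homog \<alpha> \<delta>"
proof -
  let ?K = "Poly_Mapping.keys \<gamma> \<union> Poly_Mapping.keys \<delta>"
  show ?thesis
    using keys_add[of \<gamma> \<delta>] homog_superset[of ?K \<gamma> \<alpha>] homog_superset[of ?K \<delta> \<alpha>] homog_superset[of ?K "\<gamma> + \<delta>" \<alpha>]
    by (simp add: lookup_add distrib_right sum.distrib)
qed

lemma homog_single: "homog \<alpha> (Poly_Mapping.single v 1) = weight \<alpha> v"
  by (simp add: homog_eq_sum)

lemma weight_vidx: "n \<noteq> 0 \<Longrightarrow> weight \<alpha> (vidx n) = real (size_idx n)"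
  by (simp add: weight_def vidx_def Abs_nz_index_inverse)

text \<open>The polynomials all of whose monomials have degree at least \<open>c\<close>.\<close>

definition filt :: "real \<Rightarrow> real \<Rightarrow> 'd::finite alg set" where
  "filt \<alpha> c = {p. \<forall>\<beta>\<in>Poly_Mapping.keys p. c \<le> homog \<alpha> \<beta>}"

lemma filt_0: "0 \<in> filt \<alpha> c"
  by (simp add: filt_def)

lemma filt_add: "p \<in> filt \<alpha> c \<Longrightarrow> q \<in> filt \<alpha> c \<Longrightarrow> p + q \<in> filt \<alpha> c"
  using keys_add[of p q] by (auto simp: filt_def)

lemma filt_scaleR: "p \<in> filt \<alpha> c \<Longrightarrow> r *\<^sub>R p \<in> filt \<alpha> c"
  by (auto simp: filt_def in_keys_iff)

lemma filt_mult:
  assumes "p \<in> filt \<alpha> c" "q \<in> filt \<alpha> c'"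
  shows "p * q \<in> filt \<alpha> (c + c')"
  unfolding filt_def mem_Collect_eq
proof
  fix \<beta> assume "\<beta> \<in> Poly_Mapping.keys (p * q)"
  then obtain \<gamma> \<delta> where "\<beta> = \<gamma> + \<delta>" "\<gamma> \<in> Poly_Mapping.keys p" "\<delta> \<in> Poly_Mapping.keys q"
    using keys_mult[of p q] by blast
  then show "c + c' \<le> homog \<alpha> \<beta>" using assms by (simp add: filt_def homog_add add_mono)
qed

lemma filt_Sum_any:
  assumes "\<And>k. f k \<in> filt \<alpha> c"
  shows "Sum_any f \<in> filt \<alpha> c"
proof (cases "finite {k. f k \<noteq> 0}")
  case True
  have "sum f S \<in> filt \<alpha> c" if "finite S" for S
    using that by (induction S rule: finite_induct) (auto simp: filt_0 filt_add assms)
  then show ?thesis using True by (simp add: Sum_any.expand_set)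
qed (simp add: filt_0)

lemma filt_zmon: "zmon \<gamma> \<in> filt \<alpha> (homog \<alpha> \<gamma>)"
  by (simp add: filt_def zmon_def)

lemma filt_zvar: "zvar v \<in> filt \<alpha> (weight \<alpha> v)"
  using filt_zmon[of "Poly_Mapping.single v 1" \<alpha>] homog_single[of \<alpha> v] by (simp add: zmon_def zvar_def)

lemma filt_of_nat_mult: "p \<in> filt \<alpha> c \<Longrightarrow> of_nat k * p \<in> filt \<alpha> c"
  using filt_scaleR[of p \<alpha> c "real k"] by (simp add: alg_scaleR_eq)

lemma filt_pd: "pd v (zmon \<gamma>) \<in> filt \<alpha> (homog \<alpha> \<gamma> - weight \<alpha> v)"
proof (cases "Poly_Mapping.lookup \<gamma> v = 0")
  case False
  have "\<gamma> = (\<gamma> - Poly_Mapping.single v 1) + Poly_Mapping.single v 1"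
    using False by (intro poly_mapping_eqI) (auto simp: lookup_add lookup_minus lookup_single when_def)
  then have "homog \<alpha> \<gamma> = homog \<alpha> (\<gamma> - Poly_Mapping.single v 1) + weight \<alpha> v"
    by (metis homog_add homog_single)
  then show ?thesis unfolding pd_zmon
    using filt_zmon[of "\<gamma> - Poly_Mapping.single v 1" \<alpha>] by (intro filt_scaleR) simp
qed (simp add: pd_zmon filt_0)

lemma filt_Dop: "app (Dop n) (zmon \<gamma>) \<in> filt \<alpha> (homog \<alpha> \<gamma> - real (size_idx n))"
proof (cases "n = 0")
  case True
  have "of_nat (k + 1) * zvar (Inl (k + 1)) * pd (Inl k) (zmon \<gamma>) \<in> filt \<alpha> (homog \<alpha> \<gamma>)" for k
    using filt_of_nat_mult[OF filt_mult[OF filt_zvar[of "Inl (k + 1)" \<alpha>] filt_pd[of "Inl k" \<gamma> \<alpha>]], of "k + 1"]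
    unfolding mult.assoc by (simp add: weight_def)
  from filt_Sum_any[OF this] show ?thesis
    using True by (simp add: Dop_def Dzero.rep_eq size_idx_def)
next
  case False
  then show ?thesis using filt_pd[of "vidx n" \<gamma> \<alpha>] by (simp add: Dop_def Dvar.rep_eq weight_vidx)
qed

lemma filt_partial: "app (partial i) (zmon \<gamma>) \<in> filt \<alpha> (homog \<alpha> \<gamma> + 1)"
proof -
  have "of_nat (n $ i + 1) * zvar (vidx (n + axis i 1)) * app (Dop n) (zmon \<gamma>) \<in> filt \<alpha> (homog \<alpha> \<gamma> + 1)" for n
  proof -
    have "n + axis i 1 \<noteq> 0" by (auto simp: vec_eq_iff intro!: exI[of _ i])
    then have "weight \<alpha> (vidx (n + axis i 1)) = real (size_idx n) + 1"
      by (simp add: weight_vidx size_idx_add size_idx_axis)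
    then show ?thesis
      using filt_of_nat_mult[OF filt_mult[OF filt_zvar[of "vidx (n + axis i 1)" \<alpha>] filt_Dop[of n \<gamma> \<alpha>]], of "n $ i + 1"]
      unfolding mult.assoc by (simp add: algebra_simps)
  qed
  from filt_Sum_any[OF this] show ?thesis by (simp add: partial.rep_eq)
qed

lemma tensor_filt_in_space_L:
  assumes "p \<in> filt \<alpha> c" "c > real (size_idx n)"
  shows "tensor p (Dop n) \<in> space_L \<alpha>"
proof -
  have "tensor p (Dop n) = (\<Sum>\<gamma>\<in>Poly_Mapping.keys p. tensor (Poly_Mapping.single \<gamma> (Poly_Mapping.lookup p \<gamma>)) (Dop n))"
    by (subst poly_mapping_eq_sum_single[of p]) (rule linear_sum[OF linear_tensor_left])
  also have "\<dots> = (\<Sum>\<gamma>\<in>Poly_Mapping.keys p. Poly_Mapping.lookup p \<gamma> *\<^sub>R tensor (zmon \<gamma>) (Dop n))"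
    by (simp add: single_eq_scaleR_zmon linear_scale[OF linear_tensor_left])
  also have "\<dots> \<in> space_L \<alpha>" unfolding space_L_def
    by (intro span_sum span_scale span_base zmon_Dop_in_basis) (use assms in \<open>force simp: filt_def\<close>)
  finally show ?thesis .
qed

lemma tri_basis_in_space_L:
  assumes u: "u \<in> basis_L \<alpha>" and v: "v \<in> basis_L \<alpha>"
  shows "tri u v \<in> space_L \<alpha>"
  using v
proof (cases rule: basis_L_cases)
  case (1 i)
  have a: "app D 1 = 0" for D :: "'a der" using app_mult[of D 1 1] by simp
  from u have "\<exists>a D. u = tensor a D" by (cases rule: basis_L_cases) blast+
  then show ?thesis
    by (auto simp: 1 tri_tensor a space_L_def span_zero linear_0[OF linear_tensor_left])
next
  case (2 \<gamma> n)
  show ?thesis using u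
  proof (cases rule: basis_L_cases)
    case (1 i)
    show ?thesis unfolding 1 2 tri_tensor mult_1
      by (rule tensor_filt_in_space_L[OF filt_partial]) (use 2 in simp)
  next
    case (2 \<delta> m)
    show ?thesis unfolding 2 \<open>v = _\<close> tri_tensor
      by (rule tensor_filt_in_space_L[OF filt_mult[OF filt_zmon filt_Dop]])
         (use 2 \<open>homog \<alpha> \<gamma> > _\<close> in simp)
  qed
qed

lemma tri_in_space_L:
  assumes x: "x \<in> space_L \<alpha>" and y: "y \<in> space_L \<alpha>"
  shows "tri x y \<in> space_L \<alpha>"
proof -
  have sub: "subspace {x. f x \<in> space_L \<alpha>}" if "linear f" for f :: "'a tens \<Rightarrow> 'a tens"
    using that by (auto simp: subspace_def space_L_def linear_0 linear_add linear_scale span_zero span_add span_scale)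
  have 1: "tri u y \<in> space_L \<alpha>" if "u \<in> basis_L \<alpha>" for u
    using span_induct[OF y[unfolded space_L_def] sub[OF tri_linear_right[of u]]]
      tri_basis_in_space_L[OF that] by simp
  show ?thesis
    using span_induct[OF x[unfolded space_L_def] sub[OF tri_linear_left[of y]]] 1 by simp
qed

lemma btri_in_space_L: "x \<in> space_L \<alpha> \<Longrightarrow> y \<in> space_L \<alpha> \<Longrightarrow> btri \<alpha> x y \<in> space_L \<alpha>"
  using tri_in_space_L[of x \<alpha> y] dia_in_space_L[of \<alpha> x y] by (simp add: btri_def space_L_def span_add)

end

theory Submission
  imports Defs
begin

text \<open>A coefficient of \<open>u \<triangleright> v\<close> or \<open>u \<diamond> v\<close> determines \<open>(u, v)\<close> up to finitely many choices:
  each derivation \<open>D\<^sup>(\<^sup>n\<^sup>)\<close> or \<open>\<partial>\<^sub>i\<close> lowers the exponent of a monomial by one variable, and that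
  variable can be recovered from \<open>n\<close> or from a variable that the derivation inserted into the
  result. The only unbounded parameter left is the index \<open>n\<close> of the derivation in
  \<open>u = z\<^sup>\<delta> \<otimes> D\<^sup>(\<^sup>n\<^sup>)\<close>; the condition \<open>|\<delta>| > |n|\<close> bounds it, as \<open>z\<^sup>\<delta>\<close> divides the result.\<close>

section \<open>Coefficients of \<open>space_L\<close> through the dual functionals\<close>

text \<open>Linear maps that agree on a spanning set agree. This replaces
  \<open>representation\<close> by an explicit functional, so that a coefficient of a product can be
  computed without expanding the product in the basis.\<close>

lemma coeff_L_unique:
  assumes x: "x \<in> space_L \<alpha>" and f: "linear f"
    and b: "\<And>v. v \<in> basis_L \<alpha> \<Longrightarrow> f v = (if v = w then 1 else 0)"
  shows "coeff_L \<alpha> x w = f x"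
proof -
  \<comment> \<open>Membership in \<open>space_L\<close> is kept in the set because
    \<open>coeff_L_add\<close> and \<open>coeff_L_scaleR\<close> require it.\<close>
  have "subspace {x \<in> space_L \<alpha>. coeff_L \<alpha> x w = f x}"
    by (auto simp: subspace_def space_L_def span_zero span_add span_scale linear_0[OF f] linear_add[OF f]
        linear_scale[OF f] coeff_L_add[unfolded space_L_def] coeff_L_scaleR[unfolded space_L_def]
        representation_zero coeff_L_def[of \<alpha> 0])
  moreover have "v \<in> {x \<in> space_L \<alpha>. coeff_L \<alpha> x w = f x}" if "v \<in> basis_L \<alpha>" for v
    using that b[OF that] by (auto simp: coeff_L_basis basis_in_space_L)
  ultimately show ?thesis
    using span_induct[OF x[unfolded space_L_def], of "\<lambda>x. x \<in> space_L \<alpha> \<and> coeff_L \<alpha> x w = f x"] by simp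
qed

lemma lookup_zmon: "Poly_Mapping.lookup (zmon \<gamma>) \<beta> = (if \<beta> = \<gamma> then 1 else 0)"
  by (simp add: zmon_def lookup_single when_def)

lemma coeff_L_partial:
  assumes "x \<in> space_L \<alpha>"
  shows "coeff_L \<alpha> x (tensor 1 (partial i)) = psi i (Poly_Mapping.lookup x 0)"
proof (rule coeff_L_unique[OF assms])
  show "linear (\<lambda>x. psi i (Poly_Mapping.lookup x 0))"
    using linear_compose[OF linear_lookup linear_psi] by (simp add: o_def)
  fix v :: "'a tens" assume "v \<in> basis_L \<alpha>"
  then show "psi i (Poly_Mapping.lookup v 0) = (if v = tensor 1 (partial i) then 1 else 0)"
    by (cases rule: basis_L_cases)
      (auto simp: lookup_tensor linear_scale[OF linear_psi] psi_partial psi_Dop)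
qed

lemma coeff_L_Dop:
  assumes "x \<in> space_L \<alpha>" "homog \<alpha> \<beta> > real (size_idx m)"
  shows "coeff_L \<alpha> x (tensor (zmon \<beta>) (Dop m)) = phi m (Poly_Mapping.lookup x \<beta>)"
proof (rule coeff_L_unique[OF assms(1)])
  show "linear (\<lambda>x. phi m (Poly_Mapping.lookup x \<beta>))"
    using linear_compose[OF linear_lookup linear_phi] by (simp add: o_def)
  \<comment> \<open>The elements \<open>tensor 1 (partial j)\<close> are supported at exponent 0, so
    they have no entry at \<beta>.\<close>
  have "\<beta> \<noteq> 0" using assms(2) by auto
  fix v :: "'a tens" assume "v \<in> basis_L \<alpha>"
  then show "phi m (Poly_Mapping.lookup v \<beta>) = (if v = tensor (zmon \<beta>) (Dop m) then 1 else 0)"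
    using \<open>\<beta> \<noteq> 0\<close> by (cases rule: basis_L_cases)
      (auto simp: lookup_tensor lookup_zmon lookup_one linear_scale[OF linear_phi]
        linear_0[OF linear_phi] phi_Dop)
qed

section \<open>Finiteness of sets of exponents\<close>

lemma finite_size_idx_less: "finite {n :: nat ^ 'd::finite. real (size_idx n) < c}"
proof (rule finite_imageD)
  have "n $ i \<le> nat \<lceil>c\<rceil>" if "real (size_idx n) < c" for n :: "nat ^ 'd" and i
  proof -
    have "n $ i \<le> size_idx n" unfolding size_idx_def by (rule member_le_sum) auto
    then show ?thesis using that by linarith
  qed
  then have "vec_nth ` {n :: nat ^ 'd. real (size_idx n) < c} \<subseteq> UNIV \<rightarrow>\<^sub>E {..nat \<lceil>c\<rceil>}"
    by auto
  then show "finite (vec_nth ` {n :: nat ^ 'd. real (size_idx n) < c})"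
    by (rule finite_subset) (simp add: finite_PiE)
qed (simp add: inj_on_def vec_nth_inject)

text \<open>Each \<delta> lies pointwise below \<beta>, which bounds its support and its values;
  \<epsilon> is then the difference.\<close>

lemma finite_decompositions: "finite {(\<delta>, \<epsilon>). \<delta> + \<epsilon> = (\<beta> :: 'a \<Rightarrow>\<^sub>0 nat)}"
proof (rule finite_subset)
  let ?A = "{\<delta>. \<exists>\<epsilon>. \<delta> + \<epsilon> = \<beta>}"
  show "{(\<delta>, \<epsilon>). \<delta> + \<epsilon> = \<beta>} \<subseteq> (\<lambda>\<delta>. (\<delta>, \<beta> - \<delta>)) ` ?A"
    by (auto simp: image_iff)
  \<comment> \<open>For \<beta> = 0 this is a maximum over the empty set, but then there is no key
    whose value it has to bound.\<close>
  let ?N = "Max (Poly_Mapping.lookup \<beta> ` Poly_Mapping.keys \<beta>)"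
  have "finite ?A"
  proof (rule finite_imageD)
    have "Poly_Mapping.lookup ` ?A \<subseteq> {f. \<forall>v. (v \<in> Poly_Mapping.keys \<beta> \<longrightarrow> f v \<in> {..?N})
        \<and> (v \<notin> Poly_Mapping.keys \<beta> \<longrightarrow> f v = 0)}"
      by (auto simp: lookup_add in_keys_iff Max_ge_iff intro!: Max_ge[THEN order_trans[rotated]])
    then show "finite (Poly_Mapping.lookup ` ?A)"
      by (rule finite_subset) (rule finite_set_of_finite_funs; simp)
  qed (simp add: inj_on_def)
  then show "finite ((\<lambda>\<delta>. (\<delta>, \<beta> - \<delta>)) ` ?A)" by simp
qed

text \<open>A \<open>Sum_any\<close> with infinitely many nonzero terms is 0 and has no keys, so
  this case is covered too.\<close>

lemma keys_Sum_any_obtains: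
  assumes "\<beta> \<in> Poly_Mapping.keys (Sum_any f)"
  obtains k where "\<beta> \<in> Poly_Mapping.keys (f k)"
  using assms keys_sum[of f "{k. f k \<noteq> 0}"] by (fastforce simp: Sum_any.expand_set split: if_splits)

lemma keys_of_nat_mult: "Poly_Mapping.keys (of_nat k * p :: 'd alg) \<subseteq> Poly_Mapping.keys p"
proof -
  have "of_nat k * p = real k *\<^sub>R p" by (simp add: alg_scaleR_eq)
  then show ?thesis by (auto simp: in_keys_iff)
qed

text \<open>Multiplication by a variable only shifts exponents. The inserted variable thus stays
  visible in \<beta>, which leaves finitely many candidates for it.\<close>

lemma keys_zvar_mult:
  assumes "\<beta> \<in> Poly_Mapping.keys (of_nat k * zvar v * p :: 'd alg)"
  shows "v \<in> Poly_Mapping.keys \<beta>" "\<beta> - Poly_Mapping.single v 1 \<in> Poly_Mapping.keys p"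
proof -
  have "\<beta> \<in> Poly_Mapping.keys (zvar v * p)"
    using assms keys_of_nat_mult unfolding mult.assoc by blast
  then obtain \<gamma> where "\<gamma> \<in> Poly_Mapping.keys p" "\<beta> = Poly_Mapping.single v 1 + \<gamma>"
    using keys_mult[of "zvar v" p] by (auto simp: zvar_def split: if_splits)
  then show "v \<in> Poly_Mapping.keys \<beta>" "\<beta> - Poly_Mapping.single v 1 \<in> Poly_Mapping.keys p"
    by (simp_all add: in_keys_iff lookup_add)
qed

text \<open>A nonzero coefficient forces \<open>v\<close> to occur in \<gamma>, so the subtraction
  of exponents is not truncated and can be undone.\<close>

lemma keys_pd_zmon:
  assumes "\<beta> \<in> Poly_Mapping.keys (pd v (zmon \<gamma>))"
  shows "\<gamma> = \<beta> + Poly_Mapping.single v 1"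
proof -
  have "Poly_Mapping.lookup \<gamma> v \<noteq> 0" "\<beta> = \<gamma> - Poly_Mapping.single v 1"
    using assms by (auto simp: pd_zmon in_keys_iff lookup_zmon split: if_splits)
  then show ?thesis
    by (intro poly_mapping_eqI) (auto simp: lookup_add lookup_minus lookup_single when_def)
qed

lemma finite_Dop_preimage: "finite {\<gamma>. \<beta> \<in> Poly_Mapping.keys (app (Dop n) (zmon \<gamma>))}"
proof (cases "n = 0")
  case True
  let ?K = "{k. Inl (k + 1) \<in> Poly_Mapping.keys \<beta>}"
  \<comment> \<open>Inverse of the \<open>k\<close>-th term of \<open>Dzero\<close>: remove the
    inserted z_(k+1) and restore the z_k that was differentiated away.\<close>
  let ?g = "\<lambda>k. \<beta> - Poly_Mapping.single (Inl (k + 1)) 1 + Poly_Mapping.single (Inl k) 1"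
  have "finite ?K"
    using finite_vimageI[of "Poly_Mapping.keys \<beta>" "\<lambda>k. Inl (k + 1)"] by (simp add: vimage_def inj_def)
  moreover have "{\<gamma>. \<beta> \<in> Poly_Mapping.keys (app (Dop n) (zmon \<gamma>))} \<subseteq> ?g ` ?K"
  proof
    fix \<gamma> assume "\<gamma> \<in> {\<gamma>. \<beta> \<in> Poly_Mapping.keys (app (Dop n) (zmon \<gamma>))}"
    then have "\<beta> \<in> Poly_Mapping.keys
        (Sum_any (\<lambda>k. of_nat (k + 1) * zvar (Inl (k + 1)) * pd (Inl k) (zmon \<gamma>)))"
      using True by (simp add: Dop_def Dzero.rep_eq)
    then obtain k where
      "\<beta> \<in> Poly_Mapping.keys (of_nat (k + 1) * zvar (Inl (k + 1)) * pd (Inl k) (zmon \<gamma>))"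
      by (rule keys_Sum_any_obtains)
    from keys_zvar_mult[OF this] show "\<gamma> \<in> ?g ` ?K"
      using keys_pd_zmon by blast
  qed
  ultimately show ?thesis by (meson finite_imageI finite_subset)
next
  case False
  then have "{\<gamma>. \<beta> \<in> Poly_Mapping.keys (app (Dop n) (zmon \<gamma>))} \<subseteq> {\<beta> + Poly_Mapping.single (vidx n) 1}"
    using keys_pd_zmon by (auto simp: Dop_def Dvar.rep_eq)
  then show ?thesis by (rule finite_subset) simp
qed

text \<open>The \<open>n\<close>-th term inserts the variable of index n + e_i. This must occur in
  \<beta> and determines \<open>n\<close>, so only finitely many terms of the infinite sum
  matter.\<close>

lemma finite_partial_preimage: "finite {\<gamma>. \<beta> \<in> Poly_Mapping.keys (app (partial i) (zmon \<gamma>))}"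
proof -
  let ?v = "\<lambda>n. vidx (n + axis i 1)"
  let ?N = "{n. ?v n \<in> Poly_Mapping.keys \<beta>}"
  let ?P = "\<lambda>n. {\<gamma>. \<beta> - Poly_Mapping.single (?v n) 1 \<in> Poly_Mapping.keys (app (Dop n) (zmon \<gamma>))}"
  have "n + axis i 1 \<noteq> 0" for n :: "nat ^ 'a" by (auto simp: vec_eq_iff intro!: exI[of _ i])
  then have "inj ?v" by (simp add: inj_def vidx_def Abs_nz_index_inject)
  then have "finite ?N"
    using finite_vimageI[of "Poly_Mapping.keys \<beta>" ?v] by (simp add: vimage_def)
  moreover have "{\<gamma>. \<beta> \<in> Poly_Mapping.keys (app (partial i) (zmon \<gamma>))} \<subseteq> (\<Union>n\<in>?N. ?P n)"
  proof
    fix \<gamma> assume "\<gamma> \<in> {\<gamma>. \<beta> \<in> Poly_Mapping.keys (app (partial i) (zmon \<gamma>))}"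
    then have "\<beta> \<in> Poly_Mapping.keys (Sum_any (\<lambda>n. of_nat (n $ i + 1) * zvar (?v n) * app (Dop n) (zmon \<gamma>)))"
      by (simp add: partial.rep_eq)
    then obtain n where "\<beta> \<in> Poly_Mapping.keys (of_nat (n $ i + 1) * zvar (?v n) * app (Dop n) (zmon \<gamma>))"
      by (rule keys_Sum_any_obtains)
    from keys_zvar_mult[OF this] show "\<gamma> \<in> (\<Union>n\<in>?N. ?P n)" by blast
  qed
  moreover have "finite (?P n)" for n by (rule finite_Dop_preimage)
  ultimately show ?thesis by (meson finite_UN_I finite_subset)
qed

text \<open>The choices are made in the order (\<delta>, \<epsilon>), \<open>n\<close>, \<gamma>.
  The degree bound is essential: otherwise every nonzero \<open>n\<close> would contribute the
  exponent \<epsilon> increased by one at \<open>vidx n\<close>.\<close>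

lemma finite_zmon_Dop_preimage:
  "finite {(\<delta>, n, \<gamma>). homog \<alpha> \<delta> > real (size_idx n)
     \<and> \<beta> \<in> Poly_Mapping.keys (zmon \<delta> * app (Dop n) (zmon \<gamma>))}" (is "finite ?S")
proof -
  let ?T = "SIGMA (\<delta>, \<epsilon>) : {(\<delta>, \<epsilon>). \<delta> + \<epsilon> = \<beta>}. SIGMA n : {n. real (size_idx n) < homog \<alpha> \<delta>}.
     {\<gamma>. \<epsilon> \<in> Poly_Mapping.keys (app (Dop n) (zmon \<gamma>))}"
  have "finite ?T"
    by (intro finite_SigmaI finite_decompositions)
      (auto intro!: finite_SigmaI finite_size_idx_less finite_Dop_preimage)
  moreover have "?S \<subseteq> (\<lambda>((\<delta>, \<epsilon>), n, \<gamma>). (\<delta>, n, \<gamma>)) ` ?T"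
  proof clarify
    fix \<delta> n \<gamma> assume n: "homog \<alpha> \<delta> > real (size_idx n)"
      and "\<beta> \<in> Poly_Mapping.keys (zmon \<delta> * app (Dop n) (zmon \<gamma>))"
    then obtain \<epsilon> where "\<epsilon> \<in> Poly_Mapping.keys (app (Dop n) (zmon \<gamma>))" "\<beta> = \<delta> + \<epsilon>"
      using keys_mult[of "zmon \<delta>" "app (Dop n) (zmon \<gamma>)"] by (auto simp: zmon_def split: if_splits)
    with n have "((\<delta>, \<epsilon>), n, \<gamma>) \<in> ?T" by simp
    then show "(\<delta>, n, \<gamma>) \<in> (\<lambda>((\<delta>, \<epsilon>), n, \<gamma>). (\<delta>, n, \<gamma>)) ` ?T" by (force intro: image_eqI)
  qed
  ultimately show ?thesis by (meson finite_imageI finite_subset)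
qed

section \<open>The products of basis elements\<close>

lemma btri_partial_right:
  assumes "u \<in> basis_L \<alpha>"
  shows "btri \<alpha> u (tensor 1 (partial i)) = 0"
proof -
  \<comment> \<open>The Leibniz rule for 1 * 1.\<close>
  have "app D 1 = 0" for D :: "'a der" using app_mult[of D 1 1] by simp
  moreover from assms have "\<exists>a D. u = tensor a D" by (cases rule: basis_L_cases) blast+
  ultimately show ?thesis
    by (auto simp: btri_def tri_tensor dia_partial_right linear_0[OF linear_tensor_left])
qed

lemma btri_partial_Dop:
  assumes "homog \<alpha> \<gamma> > real (size_idx n)"
  shows "btri \<alpha> (tensor 1 (partial i)) (tensor (zmon \<gamma>) (Dop n))
       = tensor (app (partial i) (zmon \<gamma>)) (Dop n)
         + (- real (n $ i)) *\<^sub>R tensor (zmon \<gamma>) (Dop (n - axis i 1))"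
  by (simp only: btri_def tri_tensor dia_partial_Dop[OF assms] mult_1)

lemma btri_Dop_Dop:
  assumes "homog \<alpha> \<delta> > real (size_idx k)"
  shows "btri \<alpha> (tensor (zmon \<delta>) (Dop k)) (tensor (zmon \<gamma>) (Dop n))
       = tensor (zmon \<delta> * app (Dop k) (zmon \<gamma>)) (Dop n)"
  by (simp add: btri_def tri_tensor dia_Dop_left[OF assms])

text \<open>Every nonzero product is a combination of tensors with some \<open>Dop\<close> on the
  right, and \<open>psi\<close> vanishes on these.\<close>

lemma coeff_L_btri_partial:
  assumes "u \<in> basis_L \<alpha>" "v \<in> basis_L \<alpha>"
  shows "coeff_L \<alpha> (btri \<alpha> u v) (tensor 1 (partial i)) = 0"
proof -
  have "coeff_L \<alpha> (btri \<alpha> u v) (tensor 1 (partial i)) = psi i (Poly_Mapping.lookup (btri \<alpha> u v) 0)"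
    using assms by (simp add: coeff_L_partial btri_in_space_L basis_in_space_L)
  also have "\<dots> = 0"
    using assms(2)
  proof (cases rule: basis_L_cases)
    case 1
    then show ?thesis using assms(1) by (simp add: btri_partial_right linear_0[OF linear_psi])
  next
    case v: (2 \<gamma> n)
    show ?thesis using assms(1)
      by (cases rule: basis_L_cases)
        (simp_all add: v btri_partial_Dop btri_Dop_Dop lookup_minus lookup_tensor
          linear_diff[OF linear_psi] linear_scale[OF linear_psi] psi_Dop)
  qed
  finally show ?thesis .
qed

text \<open>The product \<triangleright> keeps the derivation of its right factor, which must
  therefore be \<open>Dop m\<close>; the product \<diamond> keeps the monomial and lowers the index,
  so it must start from m + e_i.\<close>

lemma coeff_L_btri_Dop_cases:
  assumes uv: "u \<in> basis_L \<alpha>" "v \<in> basis_L \<alpha>" and m: "homog \<alpha> \<beta> > real (size_idx m)"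
    and ne: "coeff_L \<alpha> (btri \<alpha> u v) (tensor (zmon \<beta>) (Dop m)) \<noteq> 0"
  obtains (tri_partial) i \<gamma> where "u = tensor 1 (partial i)" "v = tensor (zmon \<gamma>) (Dop m)"
      "\<beta> \<in> Poly_Mapping.keys (app (partial i) (zmon \<gamma>))"
  | (dia) i where "u = tensor 1 (partial i)" "v = tensor (zmon \<beta>) (Dop (m + axis i 1))"
  | (tri_Dop) \<delta> n \<gamma> where "u = tensor (zmon \<delta>) (Dop n)" "v = tensor (zmon \<gamma>) (Dop m)"
      "homog \<alpha> \<delta> > real (size_idx n)" "\<beta> \<in> Poly_Mapping.keys (zmon \<delta> * app (Dop n) (zmon \<gamma>))"
proof -
  have ne: "phi m (Poly_Mapping.lookup (btri \<alpha> u v) \<beta>) \<noteq> 0"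
    using ne uv m by (simp add: coeff_L_Dop btri_in_space_L basis_in_space_L)
  note lin = linear_add[OF linear_phi] linear_scale[OF linear_phi] linear_0[OF linear_phi]
  show thesis using uv(2)
  proof (cases rule: basis_L_cases)
    case 1
    then show thesis using ne uv(1) by (simp add: btri_partial_right lin)
  next
    case v: (2 \<gamma> n)
    show thesis using uv(1)
    proof (cases rule: basis_L_cases)
      case u: (1 i)
      \<comment> \<open>The contributions of \<triangleright> and \<diamond>; if their difference is
        nonzero, one of them is.\<close>
      have "Poly_Mapping.lookup (app (partial i) (zmon \<gamma>)) \<beta> * phi m (Dop n)
          - real (n $ i) * (Poly_Mapping.lookup (zmon \<gamma>) \<beta> * phi m (Dop (n - axis i 1))) \<noteq> 0"
        using ne unfolding u v(1) btri_partial_Dop[OF v(2)] lookup_add lookup_scaleR lookup_tensor lin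
        by simp
      then consider "Poly_Mapping.lookup (app (partial i) (zmon \<gamma>)) \<beta> * phi m (Dop n) \<noteq> 0"
        | "real (n $ i) * (Poly_Mapping.lookup (zmon \<gamma>) \<beta> * phi m (Dop (n - axis i 1))) \<noteq> 0"
        by fastforce
      then show thesis
      proof cases
        case 1
        then have "m = n" "\<beta> \<in> Poly_Mapping.keys (app (partial i) (zmon \<gamma>))"
          by (auto simp: phi_Dop in_keys_iff split: if_splits)
        then show thesis using u v by (intro tri_partial[of i \<gamma>]) simp_all
      next
        case 2
        then have "n $ i \<noteq> 0" "\<gamma> = \<beta>" and m: "m = n - axis i 1"
          unfolding phi_Dop lookup_zmon by (simp_all split: if_splits)
        \<comment> \<open>Since the \<open>i\<close>-th entry is positive, n - e_i is a true
          difference and gives \<open>n\<close> back.\<close>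
        from \<open>n $ i \<noteq> 0\<close> have n: "n = m + axis i 1"
          unfolding m by (auto simp: vec_eq_iff axis_def)
        show thesis by (rule dia[of i, OF u]) (simp only: v(1) n \<open>\<gamma> = \<beta>\<close>)
      qed
    next
      case u: (2 \<delta> k)
      show thesis
        using ne u v by (intro tri_Dop[of \<delta> k \<gamma>])
          (auto simp: btri_Dop_Dop lookup_tensor lin phi_Dop in_keys_iff split: if_splits)
    qed
  qed
qed

theorem proposition4p4:
  fixes \<alpha> :: real
  assumes "0 < \<alpha>" "\<alpha> < 1"
  shows "\<forall>w \<in> (basis_L \<alpha> :: 'd::finite tens set).
    finite {(u, v) \<in> basis_L \<alpha> \<times> basis_L \<alpha>. coeff_L \<alpha> (btri \<alpha> u v) w \<noteq> 0}"
proof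
  fix w :: "'d tens"
  let ?S = "{(u, v) \<in> basis_L \<alpha> \<times> basis_L \<alpha>. coeff_L \<alpha> (btri \<alpha> u v) w \<noteq> 0}"
  assume "w \<in> basis_L \<alpha>"
  then show "finite ?S"
  proof (cases rule: basis_L_cases)
    case (1 i)
    then have "?S = {}" by (auto simp: coeff_L_btri_partial)
    then show ?thesis by (simp only: finite.emptyI)
  next
    case (2 \<beta> m)
    \<comment> \<open>\<open>?A\<close>, \<open>?B\<close> and \<open>?C\<close> collect the pairs
      of the cases \<open>tri_partial\<close>, \<open>dia\<close> and \<open>tri_Dop\<close>;
      \<open>?A\<close> and \<open>?B\<close> are indexed by the finitely many directions
      \<open>i\<close>.\<close>
    let ?A = "(\<lambda>(i, \<gamma>). (tensor 1 (partial i), tensor (zmon \<gamma>) (Dop m))) `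
      (SIGMA i : UNIV. {\<gamma>. \<beta> \<in> Poly_Mapping.keys (app (partial i) (zmon \<gamma>))})"
    let ?B = "range (\<lambda>i. (tensor 1 (partial i), tensor (zmon \<beta>) (Dop (m + axis i 1))))"
    let ?C = "(\<lambda>(\<delta>, n, \<gamma>). (tensor (zmon \<delta>) (Dop n), tensor (zmon \<gamma>) (Dop m))) `
      {(\<delta>, n, \<gamma>). homog \<alpha> \<delta> > real (size_idx n)
        \<and> \<beta> \<in> Poly_Mapping.keys (zmon \<delta> * app (Dop n) (zmon \<gamma>))}"
    have "?S \<subseteq> ?A \<union> ?B \<union> ?C"
    proof clarify
      fix u v :: "'d tens"
      assume "u \<in> basis_L \<alpha>" "v \<in> basis_L \<alpha>" "coeff_L \<alpha> (btri \<alpha> u v) w \<noteq> 0"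
        and notC: "(u, v) \<notin> ?C" and notB: "(u, v) \<notin> ?B"
      from this(1,2) 2(2) this(3)[unfolded 2(1)] show "(u, v) \<in> ?A"
      proof (cases rule: coeff_L_btri_Dop_cases)
        case (tri_partial i \<gamma>)
        then show ?thesis by (intro image_eqI[of _ _ "(i, \<gamma>)"]) simp_all
      next
        case (dia i)
        then show ?thesis using notB by blast
      next
        case (tri_Dop \<delta> n \<gamma>)
        then have "(u, v) \<in> ?C" by (intro image_eqI[of _ _ "(\<delta>, n, \<gamma>)"]) simp_all
        then show ?thesis using notC by blast
      qed
    qed
    moreover have "finite (?A \<union> ?B \<union> ?C)"
      by (intro finite_UnI finite_imageI finite_SigmaI finite_partial_preimage finite_zmon_Dop_preimage) simp_all
    ultimately show ?thesis by (rule finite_subset)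
  qed
qed

end
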